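(* The $5$-cycle and the Petersen graph are the only strongly regular graphs of girth $5$ with nonnegative condensed Ricci curvature along edges. That is, a strongly regular graph $G=(V,E)$ of girth $5$ satisfies $\Bbbk(x,y)\ge 0$ for all $xy\in E$ if and only if $G$ is isomorphic to the $5$-cycle $C_5$ or to the Petersen graph.
   Context: A strongly regular graph with parameters $(n,d,\alpha,\beta)$ is a finite undirected simple graph with $n$ vertices, all of degree $d$, such that any two adjacent vertices have exactly $\alpha\ge 0$ common neighbors and any two distinct nonadjacent vertices have exactly $\beta\ge 1$ common neighbors. The girth of a graph is the length of its shortest cycle. Let $\rho$ be the shortest-path distance on $G$ and $\Gamma(x)=\{z\in V: xz\in E\}$. A probability measure on $G$ is a function $\mu:V\to[0,1]$ with $\sum_{v\in V}\mu(v)=1$. A transport plan between probability measures $\mu$ and $\nu$ is a function $\xi:V\times V\to[0,1]$ with $\sum_{w\in V}\xi(v,w)=\mu(v)$ for all $v\in V$ and $\sum_{v\in V}\xi(v,w)=\nu(w)$ for all $w\in V$. The transport ($L^1$-Wasserstein) distance is $W(\mu,\nu)=\inf_{\xi}\sum_{x\in V}\sum_{y\in V}\rho(x,y)\,\xi(x,y)$, the infimum being over all transport plans $\xi$ between $\mu$ and $\nu$. For $0\le\varepsilon\le 1$ and $x\in V$, let $m_x^{\varepsilon}$ be the probability measure with $m_x^{\varepsilon}(x)=1-\varepsilon$, $m_x^{\varepsilon}(y)=\frac{\varepsilon}{|\Gamma(x)|}$ for $y\in\Gamma(x)$, and $m_x^{\varepsilon}(y)=0$ otherwise. For distinct $x,y\in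 V$ set $\kappa_{\varepsilon}(x,y)=1-\frac{W(m_x^{\varepsilon},m_y^{\varepsilon})}{\rho(x,y)}$. The condensed Ricci curvature is $\Bbbk(x,y)=\lim_{\varepsilon\to 0^+}\frac{\kappa_{\varepsilon}(x,y)}{\varepsilon}$ (this limit is known to exist). *)

theory Defs
  imports
    Complex_Main
    "HOL-Library.Extended_Nat"
    "Graph_Theory.Pair_Digraph"
    "Graph_Theory.Shortest_Path"
    "Graph_Theory.Digraph_Isomorphism"
begin

text \<open>
  A finite simple graph is a \<^locale>\<open>pair_graph\<close>: a finite vertex set with a symmetric and
  irreflexive set of arcs, so that an undirected edge \<open>xy\<close> is the pair of arcs \<open>(x,y)\<close>, \<open>(y,x)\<close>.
\<close>

definition nbrs :: "'a pair_pre_digraph \<Rightarrow> 'a \<Rightarrow> 'a set" where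
  "nbrs G x = {z. (x, z) \<in> parcs G}"

locale strongly_regular_graph = pair_graph G for G :: "'a pair_pre_digraph" +
  fixes n d \<alpha> \<beta> :: nat
  assumes card_verts: "card (pverts G) = n"
    and regular: "x \<in> pverts G \<Longrightarrow> card (nbrs G x) = d"
    and adjacent: "(x, y) \<in> parcs G \<Longrightarrow> card (nbrs G x \<inter> nbrs G y) = \<alpha>"
    and nonadjacent: "\<lbrakk>x \<in> pverts G; y \<in> pverts G; x \<noteq> y; (x, y) \<notin> parcs G\<rbrakk>
      \<Longrightarrow> card (nbrs G x \<inter> nbrs G y) = \<beta>"
    and beta_pos: "\<beta> \<ge> 1"

text \<open>
  In a symmetric digraph the closed walk \<open>x, y, x\<close> is a \<^const>\<open>pre_digraph.cycle\<close>; the bound on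
  the length excludes it. The girth of an acyclic graph is \<open>\<infinity>\<close>.
\<close>

definition girth :: "'a pair_pre_digraph \<Rightarrow> enat" where
  "girth G = (INF p \<in> {p. pre_digraph.cycle (with_proj G) p \<and> 3 \<le> length p}. enat (length p))"

text \<open>Meaningful for \<open>x\<close>, \<open>y\<close> in the same component; strongly regular graphs are connected
  because \<open>\<beta> \<ge> 1\<close>.\<close>

definition graph_dist :: "'a pair_pre_digraph \<Rightarrow> 'a \<Rightarrow> 'a \<Rightarrow> real" where
  "graph_dist G x y = real_of_ereal (wf_digraph.\<mu> (with_proj G) (\<lambda>_. 1) x y)"

definition transport_plans ::
    "'a pair_pre_digraph \<Rightarrow> ('a \<Rightarrow> real) \<Rightarrow> ('a \<Rightarrow> real) \<Rightarrow> ('a \<Rightarrow> 'a \<Rightarrow> real) set" where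
  "transport_plans G p q = {\<xi>.
     (\<forall>v\<in>pverts G. \<forall>w\<in>pverts G. 0 \<le> \<xi> v w \<and> \<xi> v w \<le> 1) \<and>
     (\<forall>v\<in>pverts G. (\<Sum>w\<in>pverts G. \<xi> v w) = p v) \<and>
     (\<forall>w\<in>pverts G. (\<Sum>v\<in>pverts G. \<xi> v w) = q w)}"

definition transport_dist ::
    "'a pair_pre_digraph \<Rightarrow> ('a \<Rightarrow> real) \<Rightarrow> ('a \<Rightarrow> real) \<Rightarrow> real" where
  "transport_dist G p q =
     (INF \<xi> \<in> transport_plans G p q.
        \<Sum>x\<in>pverts G. \<Sum>y\<in>pverts G. graph_dist G x y * \<xi> x y)"

definition lazy_measure :: "'a pair_pre_digraph \<Rightarrow> real \<Rightarrow> 'a \<Rightarrow> 'a \<Rightarrow> real" where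
  "lazy_measure G \<epsilon> x y =
     (if y = x then 1 - \<epsilon>
      else if y \<in> nbrs G x then \<epsilon> / real (card (nbrs G x))
      else 0)"

definition ricci_curvature :: "'a pair_pre_digraph \<Rightarrow> real \<Rightarrow> 'a \<Rightarrow> 'a \<Rightarrow> real" where
  "ricci_curvature G \<epsilon> x y =
     1 - transport_dist G (lazy_measure G \<epsilon> x) (lazy_measure G \<epsilon> y) / graph_dist G x y"

definition condensed_ricci_curvature :: "'a pair_pre_digraph \<Rightarrow> 'a \<Rightarrow> 'a \<Rightarrow> real" where
  "condensed_ricci_curvature G x y = Lim (at_right 0) (\<lambda>\<epsilon>. ricci_curvature G \<epsilon> x y / \<epsilon>)"

definition cycle5 :: "nat pair_pre_digraph" where
  "cycle5 = \<lparr> pverts = {0..<5},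
     parcs = {(i, j). i < 5 \<and> j < 5 \<and> (j = (i + 1) mod 5 \<or> i = (j + 1) mod 5)} \<rparr>"

text \<open>The Petersen graph as the Kneser graph on the 2-subsets of a 5-element set.\<close>

definition petersen :: "nat set pair_pre_digraph" where
  "petersen = \<lparr> pverts = {A. A \<subseteq> {0..<5} \<and> card A = 2},
     parcs = {(A, B). A \<subseteq> {0..<5} \<and> card A = 2 \<and> B \<subseteq> {0..<5} \<and> card B = 2 \<and> A \<inter> B = {}} \<rparr>"

text \<open>Both graphs are strongly regular of girth 5.\<close>

lemma girth_eq_5:
  assumes "strongly_regular_graph G n d 0 1"
    and "(a, b) \<in> parcs G" "(b, c) \<in> parcs G" "(c, e) \<in> parcs G" "(e, f) \<in> parcs G" "(f, a) \<in> parcs G"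
    and "distinct [a, b, c, e, f]"
  shows "girth G = 5"
proof -
  interpret strongly_regular_graph G n d 0 1 by fact
  have sym: "(y, x) \<in> parcs G" if "(x, y) \<in> parcs G" for x y
    using that pair_sym_arcs by (auto simp: symmetric_def sym_def)
  have fin: "finite (nbrs G x)" for x
    by (rule finite_subset[OF _ pair_finite_verts]) (auto simp: nbrs_def dest: in_arcsD2)
  have no3: False if "(x, y) \<in> parcs G" "(y, z) \<in> parcs G" "(z, x) \<in> parcs G" for x y z
  proof -
    have "nbrs G x \<inter> nbrs G y = {}" using adjacent[OF that(1)] fin by simp
    moreover have "z \<in> nbrs G x \<inter> nbrs G y" using that sym by (auto simp: nbrs_def)
    ultimately show False by blast
  qed
  have no4: False if "(x, y) \<in> parcs G" "(y, z) \<in> parcs G" "(z, w) \<in> parcs G" "(w, x) \<in> parcs G"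
    "x \<noteq> z" "y \<noteq> w" for x y z w
  proof -
    have na: "(x, z) \<notin> parcs G" using no3 that sym by blast
    have "card (nbrs G x \<inter> nbrs G z) = 1"
      by (rule nonadjacent) (use that na in_arcsD1 in auto)
    then obtain t where "nbrs G x \<inter> nbrs G z = {t}" by (auto simp: card_1_singleton_iff)
    moreover have "y \<in> nbrs G x \<inter> nbrs G z" "w \<in> nbrs G x \<inter> nbrs G z"
      using that sym by (auto simp: nbrs_def)
    ultimately show False using that by auto
  qed
  have ge: "5 \<le> length p" if c: "pre_digraph.cycle (with_proj G) p" "3 \<le> length p" for p
  proof (rule ccontr)
    assume "\<not> 5 \<le> length p"
    then have "length p = 3 \<or> length p = 4" using c(2) by auto
    then show False
    proof
      assume "length p = 3"
      then obtain x y z where p: "p = [x, y, z]" by (auto simp: length_Suc_conv numeral_eq_Suc)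
      obtain u where "set p \<subseteq> parcs G" "pcas u p u"
        using c(1) unfolding cycle_def awalk_def by blast
      then have "(fst x, fst y) \<in> parcs G" "(fst y, fst z) \<in> parcs G" "(fst z, fst x) \<in> parcs G"
        unfolding p by (metis list.set_intros pcas.simps prod.collapse subsetD)+
      then show False by (rule no3)
    next
      assume "length p = 4"
      then obtain x y z w where p: "p = [x, y, z, w]" by (auto simp: length_Suc_conv numeral_eq_Suc)
      obtain u where u: "set p \<subseteq> parcs G" "pcas u p u" "distinct (tl (pawalk_verts u p))"
        using c(1) unfolding cycle_def awalk_def by blast
      then have "(fst x, fst y) \<in> parcs G" "(fst y, fst z) \<in> parcs G"
          "(fst z, fst w) \<in> parcs G" "(fst w, fst x) \<in> parcs G"
        unfolding p by (metis list.set_intros pcas.simps prod.collapse subsetD)+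
      moreover have "fst x \<noteq> fst z" "fst y \<noteq> fst w" using u(2,3) unfolding p by auto
      ultimately show False by (rule no4)
    qed
  qed
  let ?C = "[(a,b),(b,c),(c,e),(e,f),(f,a)]"
  have cyc: "cycle ?C"
    unfolding cycle_def
  proof (intro exI conjI)
    show "awalk a ?C a" using assms(2-6) in_arcsD1[OF assms(2)] by (simp add: awalk_def)
    show "distinct (tl (pawalk_verts a ?C))" using assms(7) by auto
  qed simp
  show ?thesis unfolding girth_def
  proof (rule antisym)
    show "(INF p \<in> {p. pre_digraph.cycle (with_proj G) p \<and> 3 \<le> length p}. enat (length p)) \<le> 5"
      by (rule INF_lower2[of ?C]) (use cyc in \<open>auto simp: numeral_eq_enat\<close>)
    show "5 \<le> (INF p \<in> {p. pre_digraph.cycle (with_proj G) p \<and> 3 \<le> length p}. enat (length p))"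
      by (rule INF_greatest) (use ge in \<open>auto simp: numeral_eq_enat\<close>)
  qed
qed

lemma nbrs_cycle5:
  "nbrs cycle5 i = (if i < 5 then set (filter (\<lambda>j. j = (i + 1) mod 5 \<or> i = (j + 1) mod 5) [0..<5]) else {})"
  by (auto simp: nbrs_def cycle5_def)

lemma cycle5_regular:
  "\<forall>i\<in>set [0..<5]. card (set (filter (\<lambda>j. j = (i + 1) mod 5 \<or> i = (j + 1) mod 5) [0..<5])) = (2::nat)"
  by code_simp

lemma cycle5_common_nbrs:
  "\<forall>i\<in>set [0..<5]. \<forall>k\<in>set [0..<5]. i \<noteq> k \<longrightarrow>
    card (set (filter (\<lambda>j. j = (i + 1) mod 5 \<or> i = (j + 1) mod 5) [0..<5]) \<inter>
      set (filter (\<lambda>j. j = (k + 1) mod 5 \<or> k = (j + 1) mod 5) [0..<5])) =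
    (if k = (i + 1) mod 5 \<or> i = (k + 1) mod 5 then 0 else (1::nat))"
  by code_simp

lemma cycle5_no_loops: "i \<noteq> (i + 1) mod (5::nat)"
  by presburger

lemma strongly_regular_cycle5: "strongly_regular_graph cycle5 5 2 0 1"
proof
  show "finite (parcs cycle5)"
    by (rule finite_subset[of _ "{..<5} \<times> {..<5}"]) (auto simp: cycle5_def)
  show "fst e \<noteq> snd e" if "e \<in> parcs cycle5" for e
    using that cycle5_no_loops[of "fst e"] by (auto simp: cycle5_def)
  show "card (nbrs cycle5 x) = 2" if "x \<in> pverts cycle5" for x
  proof -
    from that have "x < 5" by (simp add: cycle5_def)
    then show ?thesis unfolding nbrs_cycle5 using cycle5_regular[rule_format, of x] by simp
  qed
  show "card (nbrs cycle5 x \<inter> nbrs cycle5 y) = 0" if "(x,y) \<in> parcs cycle5" for x y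
  proof -
    from that have *: "x < 5" "y < 5" "y = (x + 1) mod 5 \<or> x = (y + 1) mod 5"
      by (simp_all add: cycle5_def)
    then have "x \<noteq> y" using cycle5_no_loops by metis
    with * show ?thesis
      unfolding nbrs_cycle5 using cycle5_common_nbrs[rule_format, of x y] by (simp only: if_True) simp
  qed
  show "card (nbrs cycle5 x \<inter> nbrs cycle5 y) = 1"
    if "x \<in> pverts cycle5" "y \<in> pverts cycle5" "x \<noteq> y" "(x,y) \<notin> parcs cycle5" for x y
  proof -
    from that have "x < 5" "y < 5" "\<not> (y = (x + 1) mod 5 \<or> x = (y + 1) mod 5)"
      by (simp_all add: cycle5_def)
    with that(3) show ?thesis
      unfolding nbrs_cycle5 using cycle5_common_nbrs[rule_format, of x y] by (simp only: if_True if_False) simp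
  qed
qed (auto simp: cycle5_def symmetric_def sym_def)

lemma girth_cycle5: "girth cycle5 = 5"
  by (rule girth_eq_5[OF strongly_regular_cycle5, of 0 1 2 3 4]) (auto simp: cycle5_def)

lemma nbrs_petersen:
  assumes "A \<in> pverts petersen"
  shows "nbrs petersen A = {B. B \<subseteq> {0..<5} - A \<and> card B = 2}"
  using assms by (auto simp: nbrs_def petersen_def)

lemma common_nbrs_petersen:
  assumes "A \<in> pverts petersen" "B \<in> pverts petersen"
  shows "card (nbrs petersen A \<inter> nbrs petersen B) = (card (A \<inter> B) + 1) choose 2"
proof -
  from assms have AB: "A \<subseteq> {0..<5}" "B \<subseteq> {0..<5}" "card A = 2" "card B = 2"
    by (auto simp: petersen_def)
  then have fin: "finite A" "finite B" by (auto intro: finite_subset)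
  have "card (A \<union> B) + card (A \<inter> B) = 4"
    using card_Un_Int[OF fin] AB by simp
  moreover have "card (A \<union> B) \<le> 5" using card_mono[of "{0..<5::nat}" "A \<union> B"] AB by simp
  moreover have "card ({0..<5} - (A \<union> B)) = 5 - card (A \<union> B)"
    using card_Diff_subset[of "A \<union> B" "{0..<5}"] fin AB by simp
  ultimately have "card ({0..<5} - (A \<union> B)) = card (A \<inter> B) + 1" by linarith
  moreover have "nbrs petersen A \<inter> nbrs petersen B = {C. C \<subseteq> {0..<5} - (A \<union> B) \<and> card C = 2}"
    unfolding nbrs_petersen[OF assms(1)] nbrs_petersen[OF assms(2)] by blast
  ultimately show ?thesis using n_subsets[of "{0..<5} - (A \<union> B)" 2] by simp
qed

lemma strongly_regular_petersen: "strongly_regular_graph petersen 10 3 0 1"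
proof
  have fin: "finite A" if "A \<in> pverts petersen" for A
    using that by (auto simp: petersen_def intro: finite_subset)
  show "finite (pverts petersen)"
    by (rule finite_subset[of _ "Pow {0..<5}"]) (auto simp: petersen_def)
  show "finite (parcs petersen)"
    by (rule finite_subset[of _ "Pow {0..<5} \<times> Pow {0..<5}"]) (auto simp: petersen_def)
  show "fst e \<in> pverts petersen" "snd e \<in> pverts petersen" "fst e \<noteq> snd e"
    if "e \<in> parcs petersen" for e
    using that by (auto simp: petersen_def)
  show "symmetric (with_proj petersen)"
    by (auto simp: petersen_def symmetric_def sym_def)
  show "card (pverts petersen) = 10"
    using n_subsets[of "{0..<5::nat}" 2] by (simp add: petersen_def choose_two)
  show "card (nbrs petersen A) = 3" if "A \<in> pverts petersen" for A
    using common_nbrs_petersen[OF that that] that by (simp add: petersen_def choose_two)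
  show "card (nbrs petersen A \<inter> nbrs petersen B) = 0" if "(A, B) \<in> parcs petersen" for A B
  proof -
    from that have "A \<in> pverts petersen" "B \<in> pverts petersen" "A \<inter> B = {}"
      by (auto simp: petersen_def)
    then show ?thesis using common_nbrs_petersen[of A B] by simp
  qed
  show "card (nbrs petersen A \<inter> nbrs petersen B) = 1"
    if AB: "A \<in> pverts petersen" "B \<in> pverts petersen" "A \<noteq> B" "(A, B) \<notin> parcs petersen" for A B
  proof -
    have c: "card A = 2" "card B = 2" using AB by (auto simp: petersen_def)
    have "A \<inter> B \<noteq> {}" using AB by (auto simp: petersen_def)
    then have "card (A \<inter> B) \<noteq> 0" using fin AB(1) by simp
    moreover have "card (A \<inter> B) < 2"
    proof (rule ccontr)
      assume "\<not> ?thesis"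
      then have "A \<inter> B = A" "A \<inter> B = B"
        using card_seteq[of A "A \<inter> B"] card_seteq[of B "A \<inter> B"] fin AB(1,2) c by auto
      with AB(3) show False by simp
    qed
    ultimately have "card (A \<inter> B) = 1" by linarith
    then show ?thesis using common_nbrs_petersen[OF AB(1,2)] by (simp add: choose_two)
  qed
qed simp

lemma girth_petersen: "girth petersen = 5"
  by (rule girth_eq_5[OF strongly_regular_petersen, of "{0,1}" "{2,3}" "{0,4}" "{1,2}" "{3,4}"])
    (auto simp: petersen_def doubleton_eq_iff)

end

theory Submission
  imports Defs
begin

text \<open>
  Girth 5 forces the parameters \<open>\<alpha> = 0\<close>, \<open>\<beta> = 1\<close>, so \<open>G\<close> is a Moore graph of diameter 2 and
  \<open>n = d\<^sup>2 + 1\<close>. For an edge \<open>xy\<close>, every neighbour of \<open>x\<close> other than \<open>y\<close> has distance 2 from every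
  neighbour of \<open>y\<close> other than \<open>x\<close>. Moving these neighbours onto each other and the remaining mass
  from \<open>x\<close> to \<open>y\<close> costs \<open>1 + \<epsilon> - 3\<epsilon>/d\<close>, and a Kantorovich potential shows that this is optimal.
  Hence every edge has curvature \<open>3/d - 1\<close>, which is nonnegative iff \<open>d \<in> {2, 3}\<close>; these
  degrees determine the graph up to isomorphism, and conversely \<open>n\<close> determines \<open>d\<close>.
\<close>

section \<open>Short cycles and the girth\<close>

lemma (in pair_graph) finite_nbrs: "finite (nbrs G x)"
  by (rule finite_subset[OF _ pair_finite_verts]) (auto simp: nbrs_def dest: in_arcsD2)

lemma girth_le_length:
  assumes "pre_digraph.cycle (with_proj G) p" "length p = k" "3 \<le> k"
  shows "girth G \<le> enat k"
  unfolding girth_def assms(2)[symmetric] by (rule INF_lower) (use assms in simp)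

context pair_graph
begin

lemma girth_le_3:
  assumes "(x, y) \<in> parcs G" "(y, z) \<in> parcs G" "(z, x) \<in> parcs G"
  shows "girth G \<le> 3"
proof -
  let ?p = "[(x, y), (y, z), (z, x)]"
  have "awalk x ?p x" using assms in_arcsD1[OF assms(1)] by (simp add: awalk_def)
  moreover have "distinct [x, y, z]"
    using assms no_loops' by (auto dest: arcs_symmetric)
  ultimately have "cycle ?p" unfolding cycle_def by (intro exI[of _ x]) auto
  from girth_le_length[OF this, of 3] show ?thesis by (simp add: numeral_eq_enat)
qed

lemma girth_le_4:
  assumes "(x, y) \<in> parcs G" "(y, z) \<in> parcs G" "(z, w) \<in> parcs G" "(w, x) \<in> parcs G"
    and "x \<noteq> z" "y \<noteq> w"
  shows "girth G \<le> 4"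
proof -
  let ?p = "[(x, y), (y, z), (z, w), (w, x)]"
  have "awalk x ?p x" using assms in_arcsD1[OF assms(1)] by (simp add: awalk_def)
  moreover have "distinct [x, y, z, w]"
    using assms no_loops' by (auto dest: arcs_symmetric)
  ultimately have "cycle ?p" unfolding cycle_def by (intro exI[of _ x]) auto
  from girth_le_length[OF this, of 4] show ?thesis by (simp add: numeral_eq_enat)
qed

text \<open>A finite girth yields a cycle of length at least 3, and its second and third arcs form
  the path. The middle vertex then has two neighbours, which is the source of
  \<open>d \<ge> 2\<close>.\<close>

lemma finite_girth_imp_path:
  assumes "girth G \<noteq> \<infinity>"
  obtains x y z where "(x, y) \<in> parcs G" "(y, z) \<in> parcs G" "x \<noteq> z"
proof -
  have "{p. cycle p \<and> 3 \<le> length p} \<noteq> {}"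
  proof
    assume "{p. cycle p \<and> 3 \<le> length p} = {}"
    then have "girth G = \<infinity>" unfolding girth_def by (simp add: Inf_enat_def)
    with assms show False by contradiction
  qed
  then obtain p where p: "cycle p" "3 \<le> length p" by blast
  then obtain e1 e2 e3 q where pe: "p = e1 # e2 # e3 # q"
    by (cases p; cases "tl p"; cases "tl (tl p)") auto
  obtain u where u: "set p \<subseteq> parcs G" "pcas u p u" "distinct (tl (pawalk_verts u p))"
    using p(1) unfolding cycle_def awalk_def by blast
  \<comment> \<open>A cycle has distinct vertices only after its start is dropped. What remains is
    \<open>fst e2\<close>, \<open>fst e3\<close> and the vertices of \<open>q\<close> from
    \<open>snd e3\<close> on, so arcs 2 and 3 lie wholly in the distinct part.\<close>
  have "snd e3 \<in> set (pawalk_verts (snd e3) q)" by (cases q) (use u(2) pe in auto)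
  with u have "fst e2 \<noteq> snd e3" "snd e2 = fst e3" "e2 \<in> parcs G" "e3 \<in> parcs G"
    unfolding pe by auto
  then show ?thesis using that[of "fst e2" "fst e3" "snd e3"] by (metis prod.collapse)
qed

end

text \<open>Weak Kantorovich duality: by the marginal conditions the left-hand side is the sum of
  \<open>f u - f v\<close> against the plan, and the Lipschitz bound applies termwise.\<close>

lemma transport_cost_ge:
  assumes \<xi>: "\<xi> \<in> transport_plans G p q"
    and lip: "\<And>u v. u \<in> pverts G \<Longrightarrow> v \<in> pverts G \<Longrightarrow> f u - f v \<le> graph_dist G u v"
  shows "(\<Sum>v\<in>pverts G. f v * p v) - (\<Sum>v\<in>pverts G. f v * q v)
    \<le> (\<Sum>u\<in>pverts G. \<Sum>v\<in>pverts G. graph_dist G u v * \<xi> u v)"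
proof -
  have "(\<Sum>v\<in>pverts G. f v * p v) = (\<Sum>u\<in>pverts G. \<Sum>v\<in>pverts G. f u * \<xi> u v)"
    using \<xi> by (auto simp: transport_plans_def sum_distrib_left[symmetric])
  moreover have "(\<Sum>v\<in>pverts G. f v * q v) = (\<Sum>u\<in>pverts G. \<Sum>v\<in>pverts G. f v * \<xi> u v)"
    using \<xi> by (subst sum.swap) (auto simp: transport_plans_def sum_distrib_left[symmetric])
  ultimately have "(\<Sum>v\<in>pverts G. f v * p v) - (\<Sum>v\<in>pverts G. f v * q v)
      = (\<Sum>u\<in>pverts G. \<Sum>v\<in>pverts G. (f u - f v) * \<xi> u v)"
    by (simp add: sum_subtractf left_diff_distrib)
  also have "\<dots> \<le> (\<Sum>u\<in>pverts G. \<Sum>v\<in>pverts G. graph_dist G u v * \<xi> u v)"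
    using \<xi> lip by (intro sum_mono mult_right_mono) (auto simp: transport_plans_def)
  finally show ?thesis .
qed

section \<open>Moore graphs from girth 5\<close>

locale moore_graph = strongly_regular_graph G n d 0 1 for G :: "'a pair_pre_digraph" and n d +
  assumes degree_ge_2: "2 \<le> d" and verts_nonempty: "pverts G \<noteq> {}"

text \<open>A common neighbour of adjacent vertices closes a triangle, and two common neighbours of
  distinct vertices close a 4-cycle; \<open>\<beta> \<ge> 1\<close> leaves exactly one in the
  nonadjacent case. A path taken from a cycle excludes the empty graph, a single vertex and a single
  edge, which also meet the conditions for \<open>\<alpha> = 0\<close>,
  \<open>\<beta> = 1\<close>.\<close>

lemma moore_graph_if_girth_5:
  assumes "strongly_regular_graph G n d \<alpha> \<beta>" "girth G = 5"
  shows "moore_graph G n d"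
proof -
  interpret strongly_regular_graph G n d \<alpha> \<beta> by fact
  have no3: False if "(x, y) \<in> parcs G" "(y, z) \<in> parcs G" "(z, x) \<in> parcs G" for x y z
    using girth_le_3[OF that] assms(2) by simp
  have no4: False if "(x, y) \<in> parcs G" "(y, z) \<in> parcs G" "(z, w) \<in> parcs G" "(w, x) \<in> parcs G"
    "x \<noteq> z" "y \<noteq> w" for x y z w
    using girth_le_4[OF that] assms(2) by simp
  show ?thesis
  proof unfold_locales
    show "card (pverts G) = n" by (rule card_verts)
    show "card (nbrs G x) = d" if "x \<in> pverts G" for x using that by (rule regular)
    show "card (nbrs G x \<inter> nbrs G y) = 0" if "(x, y) \<in> parcs G" for x y
    proof -
      have "nbrs G x \<inter> nbrs G y = {}"
        using no3[OF that] arcs_symmetric unfolding nbrs_def by blast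
      then show ?thesis by simp
    qed
    show "card (nbrs G x \<inter> nbrs G y) = 1"
      if xy: "x \<in> pverts G" "y \<in> pverts G" "x \<noteq> y" "(x, y) \<notin> parcs G" for x y
    proof -
      have "card (nbrs G x \<inter> nbrs G y) \<noteq> 0" using nonadjacent[OF xy] beta_pos by simp
      then obtain z where z: "z \<in> nbrs G x \<inter> nbrs G y"
        by (metis card.empty ex_in_conv)
      have "w = z" if "w \<in> nbrs G x \<inter> nbrs G y" for w
        using no4[of x z y w] z that xy(3) arcs_symmetric unfolding nbrs_def by blast
      with z have "nbrs G x \<inter> nbrs G y = {z}" by blast
      then show ?thesis by simp
    qed
    obtain x y z where xyz: "(x, y) \<in> parcs G" "(y, z) \<in> parcs G" "x \<noteq> z"
      by (rule finite_girth_imp_path) (simp add: assms(2))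
    have "card {x, z} \<le> card (nbrs G y)"
      by (rule card_mono[OF finite_nbrs]) (use xyz(2) arcs_symmetric[OF xyz(1)] in \<open>auto simp: nbrs_def\<close>)
    then show "2 \<le> d" using xyz regular[of y] in_arcsD1[of y z] by simp
    show "pverts G \<noteq> {}" using in_arcsD1[OF xyz(1)] by blast
  qed simp
qed

section \<open>Adjacency structure and vertex count\<close>

context moore_graph
begin

lemma no_triangle: "(x, y) \<in> parcs G \<Longrightarrow> (y, z) \<in> parcs G \<Longrightarrow> (z, x) \<notin> parcs G"
proof
  assume *: "(x, y) \<in> parcs G" "(y, z) \<in> parcs G" "(z, x) \<in> parcs G"
  then have "z \<in> nbrs G x \<inter> nbrs G y" using arcs_symmetric unfolding nbrs_def by blast
  then show False using adjacent[OF *(1)] finite_nbrs by auto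
qed

text \<open>Triangle-freeness makes \<open>x\<close> and \<open>y\<close> nonadjacent, so
  \<open>\<beta> = 1\<close> applies. This is the absence of 4-cycles in the form used from here
  on.\<close>

lemma common_nbr_unique:
  assumes "(x, z) \<in> parcs G" "(z, y) \<in> parcs G" "(x, w) \<in> parcs G" "(w, y) \<in> parcs G" "x \<noteq> y"
  shows "z = w"
proof -
  have "(x, y) \<notin> parcs G" using no_triangle[OF assms(1,2)] arcs_symmetric by blast
  then have "card (nbrs G x \<inter> nbrs G y) = 1"
    using assms in_arcsD1 in_arcsD2 by (intro nonadjacent) auto
  then obtain t where "nbrs G x \<inter> nbrs G y = {t}" by (auto simp: card_1_singleton_iff)
  moreover have "z \<in> nbrs G x \<inter> nbrs G y" "w \<in> nbrs G x \<inter> nbrs G y"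
    using assms arcs_symmetric unfolding nbrs_def by blast+
  ultimately show ?thesis by auto
qed

lemma common_nbr_exists:
  assumes "x \<in> pverts G" "y \<in> pverts G" "x \<noteq> y" "(x, y) \<notin> parcs G"
  obtains z where "(x, z) \<in> parcs G" "(z, y) \<in> parcs G"
proof -
  obtain z where "nbrs G x \<inter> nbrs G y = {z}"
    using nonadjacent[OF assms] by (auto simp: card_1_singleton_iff)
  then have "z \<in> nbrs G x" "z \<in> nbrs G y" by auto
  then show ?thesis using that arcs_symmetric unfolding nbrs_def by blast
qed

text \<open>The Moore count from a root \<open>x\<close>: one root, \<open>d\<close> neighbours, and
  \<open>d - 1\<close> further neighbours of each. The latter sets are disjoint because a shared
  vertex would have two common neighbours with \<open>x\<close>, and they reach everything because
  nonadjacent vertices have a common neighbour.\<close>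

lemma card_verts_eq_degree: "n = d * d + 1"
proof -
  obtain x where x: "x \<in> pverts G" using verts_nonempty by blast
  let ?N = "nbrs G x" and ?A = "\<lambda>y. nbrs G y - {x}"
  have cA: "card (?A y) = d - 1" if "y \<in> ?N" for y
    using that finite_nbrs regular[of y] in_arcsD2 arcs_symmetric
    by (subst card_Diff_singleton) (auto simp: nbrs_def)
  have "card (\<Union>y\<in>?N. ?A y) = (\<Sum>y\<in>?N. card (?A y))"
  proof (rule card_UN_disjoint)
    show "\<forall>i\<in>?N. \<forall>j\<in>?N. i \<noteq> j \<longrightarrow> ?A i \<inter> ?A j = {}"
      using common_nbr_unique by (fastforce simp: nbrs_def)
  qed (use finite_nbrs in auto)
  also have "\<dots> = d * (d - 1)" using cA regular[OF x] by simp
  finally have U: "card (\<Union>y\<in>?N. ?A y) = d * (d - 1)" .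
  have V: "pverts G = insert x (?N \<union> (\<Union>y\<in>?N. ?A y))"
  proof
    show "pverts G \<subseteq> insert x (?N \<union> (\<Union>y\<in>?N. ?A y))"
      using common_nbr_exists[OF x] by (auto simp: nbrs_def)
    show "insert x (?N \<union> (\<Union>y\<in>?N. ?A y)) \<subseteq> pverts G"
      using x in_arcsD2 by (auto simp: nbrs_def)
  qed
  have "?N \<inter> (\<Union>y\<in>?N. ?A y) = {}"
    using no_triangle arcs_symmetric unfolding nbrs_def by blast
  then have "card (?N \<union> (\<Union>y\<in>?N. ?A y)) = d + d * (d - 1)"
    using U regular[OF x] finite_nbrs by (subst card_Un_disjoint) auto
  moreover have "x \<notin> ?N \<union> (\<Union>y\<in>?N. ?A y)" using no_loops' by (auto simp: nbrs_def)
  ultimately have "card (pverts G) = d + d * (d - 1) + 1"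
    unfolding V using finite_nbrs by (subst card_insert_disjoint) auto
  then show ?thesis using card_verts degree_ge_2 by (cases d) auto
qed

section \<open>Graph distances 0, 1 and 2\<close>

lemma graph_dist_arc:
  assumes "(x, y) \<in> parcs G"
  shows "graph_dist G x y = 1"
proof -
  have "\<mu> (\<lambda>_. 1) x y = ereal 1"
    unfolding \<mu>_def
  proof (rule antisym)
    have "awalk x [(x, y)] y" using assms by (auto simp: awalk_simps in_arcsD2)
    then show "(INF p\<in>{p. awalk x p y}. ereal (awalk_cost (\<lambda>_. 1) p)) \<le> ereal 1"
      by (intro INF_lower2) auto
    show "ereal 1 \<le> (INF p\<in>{p. awalk x p y}. ereal (awalk_cost (\<lambda>_. 1) p))"
    proof (rule INF_greatest)
      fix p assume "p \<in> {p. awalk x p y}"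
      then have "p \<noteq> []" using no_loops'[OF assms] by (auto simp: awalk_simps)
      then show "ereal 1 \<le> ereal (awalk_cost (\<lambda>_. 1) p)"
        by (cases p) (auto simp: awalk_cost_def sum_list_triv)
    qed
  qed
  then show ?thesis unfolding graph_dist_def by simp
qed

lemma graph_dist_same:
  assumes "x \<in> pverts G"
  shows "graph_dist G x x = 0"
proof -
  have "\<mu> (\<lambda>_. 1) x x = ereal 0"
    unfolding \<mu>_def
  proof (rule antisym)
    have "awalk x [] x" using assms by (auto simp: awalk_simps)
    then show "(INF p\<in>{p. awalk x p x}. ereal (awalk_cost (\<lambda>_. 1) p)) \<le> ereal 0"
      by (intro INF_lower2) auto
    show "ereal 0 \<le> (INF p\<in>{p. awalk x p x}. ereal (awalk_cost (\<lambda>_. 1) p))"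
      by (rule INF_greatest) (auto simp: awalk_cost_def sum_list_triv)
  qed
  then show ?thesis unfolding graph_dist_def by simp
qed

text \<open>The common neighbour gives a walk of length 2, and a shorter walk would force equality
  or adjacency. This completes the metric: the diameter is at most 2.\<close>

lemma graph_dist_nonadjacent:
  assumes "x \<in> pverts G" "y \<in> pverts G" "x \<noteq> y" "(x, y) \<notin> parcs G"
  shows "graph_dist G x y = 2"
proof -
  obtain z where z: "(x, z) \<in> parcs G" "(z, y) \<in> parcs G" by (rule common_nbr_exists[OF assms])
  have "\<mu> (\<lambda>_. 1) x y = ereal 2"
    unfolding \<mu>_def
  proof (rule antisym)
    have "awalk x [(x, z), (z, y)] y" using z by (auto simp: awalk_simps in_arcsD2)
    then show "(INF p\<in>{p. awalk x p y}. ereal (awalk_cost (\<lambda>_. 1) p)) \<le> ereal 2"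
      by (intro INF_lower2) auto
    show "ereal 2 \<le> (INF p\<in>{p. awalk x p y}. ereal (awalk_cost (\<lambda>_. 1) p))"
    proof (rule INF_greatest)
      fix p assume p: "p \<in> {p. awalk x p y}"
      then have "p \<noteq> []" using assms by (auto simp: awalk_simps)
      moreover have "length p \<noteq> 1"
        using p assms(4) by (auto simp: awalk_simps length_Suc_conv)
      ultimately have "2 \<le> length p" by (cases p; cases "tl p") auto
      then show "ereal 2 \<le> ereal (awalk_cost (\<lambda>_. 1) p)"
        by (auto simp: awalk_cost_def sum_list_triv)
    qed
  qed
  then show ?thesis unfolding graph_dist_def by simp
qed

section \<open>Transport cost and curvature of an edge\<close>

lemma sum_lazy_measure:
  assumes x: "x \<in> pverts G"
  shows "(\<Sum>v\<in>pverts G. f v * lazy_measure G \<epsilon> x v)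
    = (1 - \<epsilon>) * f x + \<epsilon> / d * (\<Sum>v\<in>nbrs G x. f v)"
proof -
  have nx: "x \<notin> nbrs G x" "nbrs G x \<subseteq> pverts G"
    using no_loops' in_arcsD2 by (auto simp: nbrs_def)
  have "(\<Sum>v\<in>pverts G. f v * lazy_measure G \<epsilon> x v)
      = (\<Sum>v\<in>insert x (nbrs G x). f v * lazy_measure G \<epsilon> x v)"
    by (rule sum.mono_neutral_right)
      (use x nx pair_finite_verts in \<open>auto simp: lazy_measure_def\<close>)
  also have "\<dots> = (1 - \<epsilon>) * f x + (\<Sum>v\<in>nbrs G x. f v * lazy_measure G \<epsilon> x v)"
    using nx finite_nbrs by (simp add: lazy_measure_def)
  also have "(\<Sum>v\<in>nbrs G x. f v * lazy_measure G \<epsilon> x v) = (\<Sum>v\<in>nbrs G x. \<epsilon> / d * f v)"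
    by (rule sum.cong) (use nx regular[OF x] in \<open>auto simp: lazy_measure_def\<close>)
  finally show ?thesis by (simp add: sum_distrib_left)
qed

lemma card_nbrs_minus:
  assumes "(x, y) \<in> parcs G"
  shows "card (nbrs G x - {y}) = d - 1"
  using assms finite_nbrs regular[of x] in_arcsD1[OF assms]
  by (subst card_Diff_singleton) (auto simp: nbrs_def)

text \<open>An arc between \<open>u\<close> and \<open>v\<close> would give \<open>x\<close> and
  \<open>v\<close> the two common neighbours \<open>y\<close> and \<open>u\<close>;
  \<open>u = v\<close> would close a triangle on the edge \<open>xy\<close>.\<close>

lemma graph_dist_outer:
  assumes xy: "(x, y) \<in> parcs G" and u: "u \<in> nbrs G x - {y}" and v: "v \<in> nbrs G y - {x}"
  shows "(u, v) \<notin> parcs G" "u \<noteq> v" "graph_dist G u v = 2"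
proof -
  have *: "(x, u) \<in> parcs G" "(y, v) \<in> parcs G" "u \<noteq> y" "v \<noteq> x" using u v by (auto simp: nbrs_def)
  show 1: "(u, v) \<notin> parcs G"
  proof
    assume "(u, v) \<in> parcs G"
    then have "y = u" using xy * common_nbr_unique[of x y v u] by simp
    with * show False by simp
  qed
  show 2: "u \<noteq> v" using no_triangle[OF xy, of u] * arcs_symmetric by blast
  show "graph_dist G u v = 2"
    by (rule graph_dist_nonadjacent) (use * 1 2 in_arcsD2 in auto)
qed

text \<open>The potential \<open>f\<close> below is chosen to drop by exactly the distance along every move of the
  plan that sends \<open>x\<close> to \<open>y\<close> and the other neighbours of \<open>x\<close> to those of \<open>y\<close>.\<close>

lemma transport_cost_lazy_ge:
  assumes xy: "(x, y) \<in> parcs G"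
    and \<xi>: "\<xi> \<in> transport_plans G (lazy_measure G \<epsilon> x) (lazy_measure G \<epsilon> y)"
  shows "1 + \<epsilon> - 3 * \<epsilon> / d \<le> (\<Sum>u\<in>pverts G. \<Sum>v\<in>pverts G. graph_dist G u v * \<xi> u v)"
proof -
  define X where "X = nbrs G x - {y}"
  define f :: "'a \<Rightarrow> real" where
    "f v = (if v \<in> X then 2 else if \<exists>u\<in>X. (u, v) \<in> parcs G then 1 else 0)" for v
  have xV: "x \<in> pverts G" and yV: "y \<in> pverts G" using xy in_arcsD1 in_arcsD2 by auto
  \<comment> \<open>Since \<open>f\<close> takes values in \<open>{0, 1, 2}\<close>, only arcs need
    care: a drop of 2 starts in \<open>X\<close>, but every neighbour of a vertex in
    \<open>X\<close> has value at least 1.\<close>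
  have lip: "f u - f v \<le> graph_dist G u v" if uv: "u \<in> pverts G" "v \<in> pverts G" for u v
  proof -
    consider "u = v" | "(u, v) \<in> parcs G" | "u \<noteq> v" "(u, v) \<notin> parcs G" by blast
    then show ?thesis
    proof cases
      case 1 then show ?thesis using uv by (simp add: graph_dist_same)
    next
      case 2 then show ?thesis by (auto simp: graph_dist_arc f_def)
    next
      case 3 then show ?thesis using uv by (simp add: graph_dist_nonadjacent f_def)
    qed
  qed
  have cX: "card X = d - 1" unfolding X_def by (rule card_nbrs_minus[OF xy])
  \<comment> \<open>\<open>d \<ge> 2\<close> makes \<open>X\<close> nonempty, so that
    \<open>x\<close> is adjacent to \<open>X\<close> and gets the value 1 instead of 0.\<close>
  then obtain u where u: "u \<in> X" using degree_ge_2 by fastforce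
  have "x \<notin> X" "(u, x) \<in> parcs G"
    using u no_loops' arcs_symmetric unfolding X_def nbrs_def by blast+
  then have fx: "f x = 1" using u by (auto simp: f_def)
  have "y \<notin> X" "\<not> (\<exists>u\<in>X. (u, y) \<in> parcs G)"
    using no_triangle[OF xy] arcs_symmetric unfolding X_def nbrs_def by blast+
  then have fy: "f y = 0" by (simp add: f_def)
  have fY: "f v = 0" if "v \<in> nbrs G y - {x}" for v
    using graph_dist_outer(1,2)[OF xy _ that] unfolding f_def X_def by auto
  have "nbrs G x = insert y X" "y \<notin> X" "finite X"
    using xy finite_nbrs by (auto simp: X_def nbrs_def)
  moreover have "(\<Sum>v\<in>X. f v) = 2 * real (d - 1)"
    using cX by (simp add: f_def)
  ultimately have sx: "(\<Sum>v\<in>nbrs G x. f v) = 2 * (real d - 1)"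
    using fy degree_ge_2 by (simp add: of_nat_diff)
  have "nbrs G y = insert x (nbrs G y - {x})"
    using arcs_symmetric[OF xy] by (auto simp: nbrs_def)
  then have "(\<Sum>v\<in>nbrs G y. f v) = f x + (\<Sum>v\<in>nbrs G y - {x}. f v)"
    using finite_nbrs by (metis Diff_iff finite_Diff insertI1 sum.insert)
  then have sy: "(\<Sum>v\<in>nbrs G y. f v) = 1" using fx fY by simp
  have "1 + \<epsilon> - 3 * \<epsilon> / d = (1 - \<epsilon>) * f x + \<epsilon> / d * (\<Sum>v\<in>nbrs G x. f v)
      - ((1 - \<epsilon>) * f y + \<epsilon> / d * (\<Sum>v\<in>nbrs G y. f v))"
    unfolding fx fy sx sy using degree_ge_2 by (simp add: field_simps)
  also have "\<dots> \<le> (\<Sum>u\<in>pverts G. \<Sum>v\<in>pverts G. graph_dist G u v * \<xi> u v)"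
    using transport_cost_ge[OF \<xi> lip] unfolding sum_lazy_measure[OF xV] sum_lazy_measure[OF yV] .
  finally show ?thesis .
qed

text \<open>Spreading the mass of each vertex of \<open>X\<close> evenly over \<open>Y\<close>
  spares the choice of a bijection, and costs the same because all these distances are 2.\<close>

lemma transport_plan_exists:
  assumes xy: "(x, y) \<in> parcs G" and \<epsilon>: "0 \<le> \<epsilon>" "\<epsilon> \<le> 1 / 2"
  obtains \<xi> where "\<xi> \<in> transport_plans G (lazy_measure G \<epsilon> x) (lazy_measure G \<epsilon> y)"
    and "(\<Sum>u\<in>pverts G. \<Sum>v\<in>pverts G. graph_dist G u v * \<xi> u v) = 1 + \<epsilon> - 3 * \<epsilon> / d"
proof -
  define V where "V = pverts G"
  define X where "X = nbrs G x - {y}"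
  define Y where "Y = nbrs G y - {x}"
  \<comment> \<open>\<open>b\<close> is the mass of a single neighbour; it stays in place at
    \<open>x\<close> and at \<open>y\<close>. \<open>a\<close> is the surplus of \<open>x\<close>
    over \<open>b\<close>, sent to \<open>y\<close>. \<open>c\<close> is \<open>b\<close> divided
    among the \<open>d - 1\<close> vertices of \<open>Y\<close>.\<close>
  define a where "a = 1 - \<epsilon> - \<epsilon> / d"
  define b where "b = \<epsilon> / d"
  define c where "c = \<epsilon> / (d * (real d - 1))"
  define \<xi> :: "'a \<Rightarrow> 'a \<Rightarrow> real" where
    "\<xi> u v = of_bool (u = x) * of_bool (v = y) * a + of_bool (u = x) * of_bool (v = x) * b
      + of_bool (u = y) * of_bool (v = y) * b + of_bool (u \<in> X) * of_bool (v \<in> Y) * c" for u v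
  have yx: "(y, x) \<in> parcs G" using xy by (rule arcs_symmetric)
  have fin: "finite V" using pair_finite_verts by (simp add: V_def)
  have V: "x \<in> V" "y \<in> V" "X \<subseteq> V" "Y \<subseteq> V" "x \<notin> X" "y \<notin> X" "x \<notin> Y" "y \<notin> Y" "x \<noteq> y" "X \<inter> Y = {}"
    using xy in_arcsD1 in_arcsD2 no_loops' graph_dist_outer(2)[OF xy]
    unfolding V_def X_def Y_def nbrs_def by blast+
  have "card X = d - 1" "card Y = d - 1"
    unfolding X_def Y_def by (rule card_nbrs_minus, rule xy, rule card_nbrs_minus, rule yx)
  then have cXY: "real (card X) = real d - 1" "real (card Y) = real d - 1"
    using degree_ge_2 by (auto simp: of_nat_diff)
  have d: "real d \<ge> 2" using degree_ge_2 by simp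
  \<comment> \<open>This is where \<open>\<epsilon> \<le> 1 / 2\<close> enters: with
    \<open>d \<ge> 2\<close> it gives \<open>a \<ge> 1 / 4\<close>.\<close>
  have "\<epsilon> / d \<le> \<epsilon> / 2" using d \<epsilon>(1) by (intro divide_left_mono) auto
  then have abc: "0 \<le> a" "0 \<le> b" "0 \<le> c" using \<epsilon> d by (auto simp: a_def b_def c_def)
  have cb: "(real d - 1) * c = b" using d by (simp add: c_def b_def)
  have ab: "a + b = 1 - \<epsilon>" by (simp add: a_def b_def)
  have s1: "(\<Sum>v\<in>V. of_bool (v = z)) = (1 :: real)" if "z \<in> V" for z
    using fin that by (simp add: of_bool_def sum.delta)
  have s2: "(\<Sum>v\<in>V. of_bool (v \<in> S)) = real (card S)" if "S \<subseteq> V" for S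
  proof -
    have "(\<Sum>v\<in>V. of_bool (v \<in> S)) = (\<Sum>v\<in>S. 1 :: real)"
      by (rule sum.mono_neutral_cong_right) (use fin that in auto)
    then show ?thesis by simp
  qed
  note sums = s1[OF V(1)] s1[OF V(2)] s2[OF V(3)] s2[OF V(4)] cXY
  have lx: "lazy_measure G \<epsilon> x v = of_bool (v = x) * (a + b) + of_bool (v = y) * b + of_bool (v \<in> X) * b" for v
    using V xy regular[of x] unfolding lazy_measure_def ab
    by (auto simp: X_def V_def b_def nbrs_def)
  have ly: "lazy_measure G \<epsilon> y v = of_bool (v = y) * (a + b) + of_bool (v = x) * b + of_bool (v \<in> Y) * b" for v
    using V yx regular[of y] unfolding lazy_measure_def ab
    by (auto simp: Y_def V_def b_def nbrs_def)
  have row: "(\<Sum>v\<in>V. \<xi> u v) = lazy_measure G \<epsilon> x u" for u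
  proof -
    have "(\<Sum>v\<in>V. \<xi> u v) = of_bool (u = x) * a + of_bool (u = x) * b
      + of_bool (u = y) * b + of_bool (u \<in> X) * ((real d - 1) * c)"
      unfolding \<xi>_def by (simp add: sum.distrib sum_distrib_left[symmetric]
          sum_distrib_right[symmetric] sums mult.assoc)
    also have "\<dots> = lazy_measure G \<epsilon> x u"
      unfolding lx cb by (simp add: algebra_simps)
    finally show ?thesis .
  qed
  have col: "(\<Sum>u\<in>V. \<xi> u v) = lazy_measure G \<epsilon> y v" for v
  proof -
    have "\<xi> u v = of_bool (v = y) * a * of_bool (u = x) + of_bool (v = x) * b * of_bool (u = x)
      + of_bool (v = y) * b * of_bool (u = y) + of_bool (v \<in> Y) * c * of_bool (u \<in> X)" for u
      by (simp add: \<xi>_def)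
    then have "(\<Sum>u\<in>V. \<xi> u v) = of_bool (v = y) * a + of_bool (v = x) * b
      + of_bool (v = y) * b + of_bool (v \<in> Y) * c * (real d - 1)"
      by (simp add: sum.distrib sum_distrib_left[symmetric] sums)
    also have "\<dots> = lazy_measure G \<epsilon> y v"
      unfolding ly cb[symmetric] by (simp add: algebra_simps)
    finally show ?thesis .
  qed
  have nonneg: "0 \<le> \<xi> u v" for u v unfolding \<xi>_def using abc by simp
  \<comment> \<open>An entry is at most its row sum, which is the mass of one point.\<close>
  have le1: "\<xi> u v \<le> 1" if "v \<in> V" for u v
  proof -
    have "\<xi> u v \<le> (\<Sum>w\<in>V. \<xi> u w)" using that fin nonneg by (intro member_le_sum) auto
    also have "\<dots> \<le> 1"
    proof -
      have "a + b \<le> 1" "b \<le> 1" using \<epsilon>(1) ab abc by auto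
      then show ?thesis unfolding row lx using V by (auto simp: of_bool_def)
    qed
    finally show ?thesis .
  qed
  have plan: "\<xi> \<in> transport_plans G (lazy_measure G \<epsilon> x) (lazy_measure G \<epsilon> y)"
    unfolding transport_plans_def V_def[symmetric] using nonneg le1 row col by simp
  \<comment> \<open>The stationary mass has distance 0; what is left is \<open>x\<close> to
    \<open>y\<close> at distance 1 and \<open>X\<close> to \<open>Y\<close> at distance 2.\<close>
  have "graph_dist G u v * \<xi> u v
      = of_bool (u = x) * a * of_bool (v = y) + of_bool (u \<in> X) * (2 * c) * of_bool (v \<in> Y)"
    if "u \<in> V" "v \<in> V" for u v
    using V graph_dist_same[of u] graph_dist_arc[OF xy] graph_dist_outer(3)[OF xy, of u v] that
    unfolding \<xi>_def X_def[symmetric] Y_def[symmetric] V_def[symmetric] by (auto simp: of_bool_def)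
  then have "(\<Sum>u\<in>V. \<Sum>v\<in>V. graph_dist G u v * \<xi> u v)
      = (\<Sum>u\<in>V. \<Sum>v\<in>V. of_bool (u = x) * a * of_bool (v = y)
          + of_bool (u \<in> X) * (2 * c) * of_bool (v \<in> Y))"
    by (intro sum.cong) auto
  also have "\<dots> = (\<Sum>u\<in>V. a * of_bool (u = x) + 2 * c * (real d - 1) * of_bool (u \<in> X))"
    by (simp add: sum.distrib sum_distrib_left[symmetric] sums algebra_simps)
  also have "\<dots> = a + 2 * c * (real d - 1) * (real d - 1)"
    by (simp add: sum.distrib sum_distrib_left[symmetric] sums)
  also have "\<dots> = a + 2 * b * (real d - 1)" unfolding cb[symmetric] by simp
  also have "\<dots> = 1 + \<epsilon> - 3 * \<epsilon> / d" using d by (simp add: a_def b_def field_simps)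
  finally show ?thesis using that[OF plan] unfolding V_def by blast
qed

lemma transport_dist_lazy:
  assumes xy: "(x, y) \<in> parcs G" and \<epsilon>: "0 \<le> \<epsilon>" "\<epsilon> \<le> 1 / 2"
  shows "transport_dist G (lazy_measure G \<epsilon> x) (lazy_measure G \<epsilon> y) = 1 + \<epsilon> - 3 * \<epsilon> / d"
proof -
  obtain \<xi> where \<xi>: "\<xi> \<in> transport_plans G (lazy_measure G \<epsilon> x) (lazy_measure G \<epsilon> y)"
    "(\<Sum>u\<in>pverts G. \<Sum>v\<in>pverts G. graph_dist G u v * \<xi> u v) = 1 + \<epsilon> - 3 * \<epsilon> / d"
    by (rule transport_plan_exists[OF assms])
  show ?thesis unfolding transport_dist_def
  proof (rule cInf_eq_minimum)
    show "1 + \<epsilon> - 3 * \<epsilon> / d \<in> (\<lambda>\<xi>. \<Sum>u\<in>pverts G. \<Sum>v\<in>pverts G. graph_dist G u v * \<xi> u v) `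
        transport_plans G (lazy_measure G \<epsilon> x) (lazy_measure G \<epsilon> y)"
      by (rule image_eqI[where x = \<xi>]) (simp_all only: \<xi>)
  qed (use transport_cost_lazy_ge[OF xy] in auto)
qed

text \<open>By the transport formula the quotient is constant on the interval from 0 to 1/2, so the
  limit is that constant.\<close>

lemma condensed_ricci_curvature_arc:
  assumes xy: "(x, y) \<in> parcs G"
  shows "condensed_ricci_curvature G x y = 3 / d - 1"
proof -
  have "eventually (\<lambda>\<epsilon>. \<epsilon> \<in> {0<..<1/2}) (at_right (0 :: real))"
    by (rule eventually_at_right_real) simp
  then have "eventually (\<lambda>\<epsilon>. ricci_curvature G \<epsilon> x y / \<epsilon> = 3 / d - 1) (at_right 0)"
  proof eventually_elim
    case (elim \<epsilon>)
    then have \<epsilon>: "0 < \<epsilon>" "0 \<le> \<epsilon>" "\<epsilon> \<le> 1 / 2" by auto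
    have "ricci_curvature G \<epsilon> x y = (3 / d - 1) * \<epsilon>"
      unfolding ricci_curvature_def graph_dist_arc[OF xy] transport_dist_lazy[OF xy \<epsilon>(2,3)]
      by (simp add: algebra_simps)
    with \<epsilon>(1) show ?case by simp
  qed
  then have "((\<lambda>\<epsilon>. ricci_curvature G \<epsilon> x y / \<epsilon>) \<longlongrightarrow> 3 / d - 1) (at_right 0)"
    by (rule tendsto_eventually)
  then show ?thesis
    unfolding condensed_ricci_curvature_def by (intro tendsto_Lim) auto
qed

end

section \<open>Isomorphism by counting, and an explicit list for the Petersen graph\<close>

lemma (in strongly_regular_graph) card_arcs: "card (parcs G) = n * d"
proof -
  have "parcs G = (SIGMA x:pverts G. nbrs G x)"
    using in_arcsD1 by (auto simp: nbrs_def)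
  then show ?thesis
    using pair_finite_verts finite_nbrs regular card_verts by (simp add: card_SigmaI)
qed

text \<open>Equal \<open>n\<close> and \<open>d\<close> give equally many vertices and equally many
  arcs, so an injective homomorphism is onto for both. Preservation of arcs in one direction thus
  suffices.\<close>

lemma digraph_iso_if_inj_hom:
  assumes "strongly_regular_graph G n d \<alpha> \<beta>" "strongly_regular_graph H n d \<alpha>' \<beta>'"
    and inj: "inj_on h (pverts H)" and verts: "h ` pverts H \<subseteq> pverts G"
    and hom: "\<And>u v. (u, v) \<in> parcs H \<Longrightarrow> (h u, h v) \<in> parcs G"
  shows "digraph_iso (with_proj G) (with_proj H)"
proof -
  interpret G: strongly_regular_graph G n d \<alpha> \<beta> by fact
  interpret H: strongly_regular_graph H n d \<alpha>' \<beta>' by fact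
  let ?f = "\<lparr>iso_verts = h, iso_arcs = map_prod h h, iso_head = snd, iso_tail = fst\<rparr>"
  have injA: "inj_on (map_prod h h) (parcs H)"
    using H.in_arcsD1 H.in_arcsD2 inj_onD[OF inj] by (auto intro!: inj_onI)
  have "h ` pverts H = pverts G"
    by (rule card_subset_eq[OF G.pair_finite_verts verts])
      (simp add: card_image[OF inj] G.card_verts H.card_verts)
  moreover have "map_prod h h ` parcs H = parcs G"
    by (rule card_subset_eq[OF G.pair_finite_arcs])
      (use hom in \<open>auto simp: card_image[OF injA] G.card_arcs H.card_arcs\<close>)
  ultimately have "with_proj G = app_iso ?f (with_proj H)"
    by (simp add: app_iso_def with_proj_def)
  moreover have "pre_digraph.digraph_isomorphism (with_proj H) ?f"
    unfolding H.digraph_isomorphism_def using inj injA H.wf_digraph_axioms by simp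
  ultimately have "digraph_iso (with_proj H) (with_proj G)"
    unfolding digraph_iso_def by blast
  then show ?thesis by (rule digraph_iso_swap[OF H.wf_digraph_axioms])
qed

text \<open>The order is breadth-first from \<open>{0,1}\<close>: the root, its three neighbours,
  then the two further neighbours of each in turn.\<close>

lemma pverts_petersen:
  "pverts petersen =
    {{0,1}, {2,3}, {2,4}, {3,4}, {0,4}, {1,4}, {0,3}, {1,3}, {0,2}, {1,2}}" (is "_ = ?S")
proof
  show "pverts petersen \<subseteq> ?S"
  proof
    fix A assume "A \<in> pverts petersen"
    then have A: "A \<subseteq> {0..<5}" "card A = 2" by (simp_all add: petersen_def)
    obtain i j where ij: "A = {i, j}" "i \<noteq> j" using A(2) by (auto simp: card_2_iff)
    with A(1) have "i \<in> {0, 1, 2, 3, 4}" "j \<in> {0, 1, 2, 3, 4}" by auto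
    with ij show "A \<in> ?S" by (elim insertE emptyE) (simp_all add: doubleton_eq_iff)
  qed
  show "?S \<subseteq> pverts petersen" by (simp add: petersen_def)
qed

text \<open>Each of the 15 undirected edges appears in one direction only: nine tree edges of the
  breadth-first search, then the hexagon on the six vertices at distance 2 from the root.\<close>

definition petersen_edges :: "(nat set \<times> nat set) set" where
  "petersen_edges = {({0,1}, {2,3}), ({0,1}, {2,4}), ({0,1}, {3,4}), ({2,3}, {0,4}), ({2,3}, {1,4}),
    ({2,4}, {0,3}), ({2,4}, {1,3}), ({3,4}, {0,2}), ({3,4}, {1,2}), ({0,4}, {1,3}),
    ({0,4}, {1,2}), ({1,4}, {0,3}), ({1,4}, {0,2}), ({1,3}, {0,2}), ({0,3}, {1,2})}"

lemma parcs_petersen_cases: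
  assumes "(A, B) \<in> parcs petersen"
  shows "(A, B) \<in> petersen_edges \<or> (B, A) \<in> petersen_edges"
proof -
  have AB: "A \<inter> B = {}" using assms by (simp add: petersen_def)
  have "A \<in> pverts petersen" "B \<in> pverts petersen" using assms by (auto simp: petersen_def)
  then show ?thesis unfolding pverts_petersen
    by (elim insertE emptyE) (use AB in \<open>simp_all add: petersen_edges_def doubleton_eq_iff\<close>)
qed

section \<open>Reconstruction of the graph for degrees 2 and 3\<close>

context moore_graph
begin

lemma second_nbr_not_nbr: "(v, a) \<in> parcs G \<Longrightarrow> (a, u) \<in> parcs G \<Longrightarrow> (v, u) \<notin> parcs G"
  using no_triangle arcs_symmetric by blast

text \<open>Otherwise \<open>a\<close> and \<open>b\<close> would both be common neighbours of
  \<open>v\<close> and \<open>u\<close>.\<close>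

lemma second_nbrs_distinct:
  assumes "(v, a) \<in> parcs G" "(v, b) \<in> parcs G" "a \<noteq> b" "(a, u) \<in> parcs G" "(b, w) \<in> parcs G" "u \<noteq> v"
  shows "u \<noteq> w"
  using common_nbr_unique[of v a u b] assms by auto

text \<open>\<open>u\<close> and \<open>b\<close> are distinct and nonadjacent, and \<open>w\<close>
  is their common neighbour; it is not \<open>v\<close>, as \<open>u\<close> lies at distance 2 from
  \<open>v\<close>. This produces all edges between vertices at distance 2 from the root.\<close>

lemma second_nbr_matching:
  assumes va: "(v, a) \<in> parcs G" and vb: "(v, b) \<in> parcs G" and "a \<noteq> b"
    and au: "(a, u) \<in> parcs G" "u \<noteq> v"
  obtains w where "(b, w) \<in> parcs G" "w \<noteq> v" "(u, w) \<in> parcs G"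
proof -
  have "(b, u) \<notin> parcs G" using second_nbrs_distinct[OF assms(1-4) _ au(2)] by blast
  moreover have "b \<noteq> u" using second_nbr_not_nbr[OF va au(1)] vb by blast
  ultimately obtain w where w: "(b, w) \<in> parcs G" "(w, u) \<in> parcs G"
    using common_nbr_exists[of b u] vb au in_arcsD2 by metis
  moreover have "w \<noteq> v" using w(2) second_nbr_not_nbr[OF va au(1)] by blast
  ultimately show ?thesis using that arcs_symmetric by blast
qed

text \<open>Each of the two neighbours of \<open>v\<close> has one further neighbour, and matching
  joins these two. The resulting pentagon has all \<open>n = 5\<close> vertices.\<close>

lemma digraph_iso_cycle5:
  assumes "d = 2"
  shows "digraph_iso (with_proj G) (with_proj cycle5)"
proof -
  obtain v where v: "v \<in> pverts G" using verts_nonempty by blast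
  obtain a b where ab: "nbrs G v = {a, b}" "a \<noteq> b"
    using regular[OF v] assms by (auto simp: card_2_iff)
  then have va: "(v, a) \<in> parcs G" and vb: "(v, b) \<in> parcs G" by (auto simp: nbrs_def)
  have "card (nbrs G a - {v}) = 1" using card_nbrs_minus[OF arcs_symmetric[OF va]] assms by simp
  then obtain u where "u \<in> nbrs G a - {v}" by (auto simp: card_1_singleton_iff)
  then have u: "(a, u) \<in> parcs G" "u \<noteq> v" by (auto simp: nbrs_def)
  obtain w where w: "(b, w) \<in> parcs G" "w \<noteq> v" "(u, w) \<in> parcs G"
    by (rule second_nbr_matching[OF va vb ab(2) u])
  have dist: "distinct [v, a, u, w, b]"
    using va vb u w ab(2) no_loops' second_nbr_not_nbr[OF va u(1)] second_nbr_not_nbr[OF vb w(1)]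
    by auto
  \<comment> \<open>The list runs around the pentagon, so consecutive indices modulo 5 are
    adjacent.\<close>
  define h where "h i = [v, a, u, w, b] ! i" for i
  have n: "n = 5" using card_verts_eq_degree assms by simp
  have V: "pverts cycle5 = {0, 1, 2, 3, 4}" by (auto simp: cycle5_def)
  show ?thesis
  proof (rule digraph_iso_if_inj_hom[of G n d 0 1 _ 0 1 h])
    show "strongly_regular_graph G n d 0 1" by unfold_locales
    show "strongly_regular_graph cycle5 n d 0 1"
      unfolding n assms by (rule strongly_regular_cycle5)
    show "inj_on h (pverts cycle5)" using dist unfolding V h_def by (auto simp: inj_on_def)
    show "h ` pverts cycle5 \<subseteq> pverts G"
      using v va vb u w in_arcsD2 unfolding V h_def by auto
    show "(h i, h j) \<in> parcs G" if ij: "(i, j) \<in> parcs cycle5" for i j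
    proof -
      have "i \<in> {0, 1, 2, 3, 4}" "j \<in> {0, 1, 2, 3, 4}" "j = (i + 1) mod 5 \<or> i = (j + 1) mod 5"
        using ij by (auto simp: cycle5_def)
      moreover note arcs = va vb u(1) w(1,3)
      ultimately show ?thesis
        using arcs[THEN arcs_symmetric] unfolding h_def by (elim insertE emptyE) simp_all
    qed
  qed
qed

text \<open>The tree of depth 2 from \<open>v\<close> has all 10 vertices; matching and the absence
  of triangles and 4-cycles then force the hexagon on its leaves.\<close>

lemma digraph_iso_petersen:
  assumes "d = 3"
  shows "digraph_iso (with_proj G) (with_proj petersen)"
proof -
  obtain v where v: "v \<in> pverts G" using verts_nonempty by blast
  obtain a b c where abc: "nbrs G v = {a, b, c}" "a \<noteq> b" "a \<noteq> c" "b \<noteq> c"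
    using regular[OF v] assms by (auto simp: card_3_iff)
  then have va: "(v, a) \<in> parcs G" and vb: "(v, b) \<in> parcs G" and vc: "(v, c) \<in> parcs G"
    by (auto simp: nbrs_def)
  have two: "card (nbrs G z - {v}) = 2" if "(v, z) \<in> parcs G" for z
    using card_nbrs_minus[OF arcs_symmetric[OF that]] assms by simp
  \<comment> \<open>Besides naming the third neighbour \<open>q\<close>, this records that there is
    no fourth, so a match that is neither \<open>v\<close> nor \<open>p\<close> must be
    \<open>q\<close>.\<close>
  have other: "\<exists>q. (z, q) \<in> parcs G \<and> q \<noteq> v \<and> q \<noteq> p \<and> (\<forall>r. (z, r) \<in> parcs G \<longrightarrow> r = v \<or> r = p \<or> r = q)"
    if zp: "(v, z) \<in> parcs G" "(z, p) \<in> parcs G" "p \<noteq> v" for z p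
  proof -
    obtain s t where st: "nbrs G z - {v} = {s, t}" "s \<noteq> t"
      using two[OF zp(1)] by (auto simp: card_2_iff)
    then have "p = s \<or> p = t" using zp by (auto simp: nbrs_def)
    then show ?thesis using st unfolding nbrs_def by blast
  qed
  \<comment> \<open>The choice of \<open>a0\<close> fixes the labels: \<open>b1\<close> and
    \<open>c1\<close> are its matches below \<open>b\<close> and \<open>c\<close>, and
    \<open>a1\<close>, \<open>b0\<close>, \<open>c0\<close> are the remaining leaves.\<close>
  obtain a0 where "a0 \<in> nbrs G a - {v}" using two[OF va] by (metis card.empty ex_in_conv zero_neq_numeral)
  then have a0: "(a, a0) \<in> parcs G" "a0 \<noteq> v" by (auto simp: nbrs_def)
  obtain b1 where b1: "(b, b1) \<in> parcs G" "b1 \<noteq> v" "(a0, b1) \<in> parcs G"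
    by (rule second_nbr_matching[OF va vb abc(2) a0])
  obtain c1 where c1: "(c, c1) \<in> parcs G" "c1 \<noteq> v" "(a0, c1) \<in> parcs G"
    by (rule second_nbr_matching[OF va vc abc(3) a0])
  obtain a1 where a1: "(a, a1) \<in> parcs G" "a1 \<noteq> v" "a1 \<noteq> a0"
    using other[OF va a0] by blast
  obtain b0 where b0: "(b, b0) \<in> parcs G" "b0 \<noteq> v" "b0 \<noteq> b1"
    and nb: "\<And>r. (b, r) \<in> parcs G \<Longrightarrow> r = v \<or> r = b1 \<or> r = b0"
    using other[OF vb b1(1,2)] by blast
  obtain c0 where c0: "(c, c0) \<in> parcs G" "c0 \<noteq> v" "c0 \<noteq> c1"
    and nc: "\<And>r. (c, r) \<in> parcs G \<Longrightarrow> r = v \<or> r = c1 \<or> r = c0"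
    using other[OF vc c1(1,2)] by blast
  have not_a: "b1 \<noteq> a" "c1 \<noteq> a"
    using second_nbr_not_nbr[OF vb b1(1)] second_nbr_not_nbr[OF vc c1(1)] va by auto
  \<comment> \<open>The match of \<open>a1\<close> below \<open>b\<close> is not \<open>b1\<close>,
    since \<open>a0\<close> and \<open>a1\<close> already share the neighbour
    \<open>a\<close>.\<close>
  have a1b0: "(a1, b0) \<in> parcs G"
  proof -
    obtain w where w: "(b, w) \<in> parcs G" "w \<noteq> v" "(a1, w) \<in> parcs G"
      by (rule second_nbr_matching[OF va vb abc(2) a1(1,2)])
    moreover have "w \<noteq> b1"
      using common_nbr_unique[of a0 a a1 b1] a0 a1 b1 w not_a arcs_symmetric by metis
    ultimately show ?thesis using nb by blast
  qed
  have a1c0: "(a1, c0) \<in> parcs G"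
  proof -
    obtain w where w: "(c, w) \<in> parcs G" "w \<noteq> v" "(a1, w) \<in> parcs G"
      by (rule second_nbr_matching[OF va vc abc(3) a1(1,2)])
    moreover have "w \<noteq> c1"
      using common_nbr_unique[of a0 a a1 c1] a0 a1 c1 w not_a arcs_symmetric by metis
    ultimately show ?thesis using nc by blast
  qed
  \<comment> \<open>A match \<open>c1\<close> would close the triangle \<open>a0\<close>,
    \<open>b1\<close>, \<open>c1\<close>; for \<open>b0\<close> below, \<open>c0\<close> would close
    \<open>a1\<close>, \<open>b0\<close>, \<open>c0\<close>.\<close>
  have b1c0: "(b1, c0) \<in> parcs G"
  proof -
    obtain w where w: "(c, w) \<in> parcs G" "w \<noteq> v" "(b1, w) \<in> parcs G"
      by (rule second_nbr_matching[OF vb vc abc(4) b1(1,2)])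
    moreover have "w \<noteq> c1" using second_nbr_not_nbr[OF b1(3) w(3)] c1(3) by blast
    ultimately show ?thesis using nc by blast
  qed
  have b0c1: "(b0, c1) \<in> parcs G"
  proof -
    obtain w where w: "(c, w) \<in> parcs G" "w \<noteq> v" "(b0, w) \<in> parcs G"
      by (rule second_nbr_matching[OF vb vc abc(4) b0(1,2)])
    moreover have "w \<noteq> c0" using second_nbr_not_nbr[OF a1b0 w(3)] a1c0 by blast
    ultimately show ?thesis using nc by blast
  qed
  have second: "v \<noteq> z \<and> a \<noteq> z \<and> b \<noteq> z \<and> c \<noteq> z" if "z \<in> {a0, a1, b0, b1, c0, c1}" for z
    using that a0 a1 b0 b1 c0 c1 va vb vc second_nbr_not_nbr by blast
  have dist: "distinct [v, a, b, c, a0, a1, b0, b1, c0, c1]"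
  proof -
    have "a0 \<noteq> b0" "a0 \<noteq> b1" "a1 \<noteq> b0" "a1 \<noteq> b1"
      using second_nbrs_distinct[OF va vb abc(2)] a0 a1 b0 b1 by blast+
    moreover have "a0 \<noteq> c0" "a0 \<noteq> c1" "a1 \<noteq> c0" "a1 \<noteq> c1"
      using second_nbrs_distinct[OF va vc abc(3)] a0 a1 c0 c1 by blast+
    moreover have "b0 \<noteq> c0" "b0 \<noteq> c1" "b1 \<noteq> c0" "b1 \<noteq> c1"
      using second_nbrs_distinct[OF vb vc abc(4)] b0 b1 c0 c1 by blast+
    moreover have "v \<noteq> a" "v \<noteq> b" "v \<noteq> c" using va vb vc no_loops' by blast+
    moreover note abc(2-4) a1(3) b0(3) c0(3)
      second[of a0] second[of a1] second[of b0] second[of b1] second[of c0] second[of c1]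
    ultimately show ?thesis by simp
  qed
  define h :: "nat set \<Rightarrow> 'a" where
    "h A = (if A = {0,1} then v else if A = {2,3} then a else if A = {2,4} then b
      else if A = {3,4} then c else if A = {0,4} then a0 else if A = {1,4} then a1
      else if A = {0,3} then b0 else if A = {1,3} then b1 else if A = {0,2} then c0 else c1)" for A
  have h: "h {0,1} = v" "h {2,3} = a" "h {2,4} = b" "h {3,4} = c" "h {0,4} = a0" "h {1,4} = a1"
    "h {0,3} = b0" "h {1,3} = b1" "h {0,2} = c0" "h {1,2} = c1"
    by (simp_all add: h_def doubleton_eq_iff)
  have im: "h ` pverts petersen = set [v, a, b, c, a0, a1, b0, b1, c0, c1]"
    unfolding pverts_petersen by (simp only: image_insert image_empty h list.set)
  have n: "n = 10" using card_verts_eq_degree assms by simp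
  interpret P: strongly_regular_graph petersen 10 3 0 1 by (rule strongly_regular_petersen)
  show ?thesis
  proof (rule digraph_iso_if_inj_hom[of G n d 0 1 _ 0 1 h])
    show "strongly_regular_graph G n d 0 1" by unfold_locales
    show "strongly_regular_graph petersen n d 0 1"
      unfolding n assms by (rule strongly_regular_petersen)
    \<comment> \<open>Injectivity comes from counting: the image consists of 10 distinct
      vertices.\<close>
    have "card (h ` pverts petersen) = card (pverts petersen)"
      unfolding im distinct_card[OF dist] P.card_verts by simp
    then show "inj_on h (pverts petersen)"
      by (rule eq_card_imp_inj_on[OF P.pair_finite_verts])
    show "h ` pverts petersen \<subseteq> pverts G"
      unfolding im using v va vb vc a0 a1 b0 b1 c0 c1 in_arcsD2 by auto
    have "(h A, h B) \<in> parcs G" if "(A, B) \<in> petersen_edges" for A B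
      using that va vb vc a0 a1 b0 b1 c0 c1 a1b0 a1c0 b1c0 b0c1 unfolding petersen_edges_def
      by (elim insertE emptyE) (simp_all only: prod.inject h)
    then show "(h A, h B) \<in> parcs G" if "(A, B) \<in> parcs petersen" for A B
      using parcs_petersen_cases[OF that] arcs_symmetric by blast
  qed
qed

end

section \<open>The equivalence\<close>

lemma card_verts_if_digraph_iso:
  assumes "digraph_iso (with_proj G) (with_proj H)"
  shows "card (pverts G) = card (pverts H)"
proof -
  obtain f where f: "pre_digraph.digraph_isomorphism (with_proj G) f"
    "with_proj H = app_iso f (with_proj G)"
    using assms unfolding digraph_iso_def by blast
  from card_verts_iso[OF f(1)] show ?thesis
    using arg_cong[OF f(2), of verts] by simp
qed

theorem corollary1p5:
  fixes G :: "'a pair_pre_digraph" and n d \<alpha> \<beta> :: nat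
  assumes "strongly_regular_graph G n d \<alpha> \<beta>"
    and "girth G = 5"
  shows "(\<forall>x y. (x, y) \<in> parcs G \<longrightarrow> condensed_ricci_curvature G x y \<ge> 0) \<longleftrightarrow>
    digraph_iso (with_proj G) (with_proj cycle5) \<or> digraph_iso (with_proj G) (with_proj petersen)"
proof -
  interpret moore_graph G n d using assms by (rule moore_graph_if_girth_5)
  have curv: "condensed_ricci_curvature G x y \<ge> 0 \<longleftrightarrow> d \<le> 3" if "(x, y) \<in> parcs G" for x y
    unfolding condensed_ricci_curvature_arc[OF that] using degree_ge_2 by (simp add: field_simps)
  \<comment> \<open>Some edge must exist, as otherwise the curvature condition would hold vacuously
    and say nothing about \<open>d\<close>.\<close>
  obtain x where x: "x \<in> pverts G" using verts_nonempty by blast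
  have "card (nbrs G x) \<noteq> 0" using regular[OF x] degree_ge_2 by simp
  then obtain y where "(x, y) \<in> parcs G" unfolding nbrs_def by fastforce
  with curv have "(\<forall>x y. (x, y) \<in> parcs G \<longrightarrow> condensed_ricci_curvature G x y \<ge> 0) \<longleftrightarrow> d \<le> 3"
    by blast
  also have "d \<le> 3 \<longleftrightarrow>
    digraph_iso (with_proj G) (with_proj cycle5) \<or> digraph_iso (with_proj G) (with_proj petersen)"
  proof
    assume "d \<le> 3"
    then have "d = 2 \<or> d = 3" using degree_ge_2 by linarith
    then show "digraph_iso (with_proj G) (with_proj cycle5) \<or> digraph_iso (with_proj G) (with_proj petersen)"
      using digraph_iso_cycle5 digraph_iso_petersen by blast
  next
    assume "digraph_iso (with_proj G) (with_proj cycle5) \<or> digraph_iso (with_proj G) (with_proj petersen)"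
    \<comment> \<open>An isomorphism fixes the order, and \<open>n = d * d + 1\<close> then bounds
      the degree.\<close>
    then have "n = 5 \<or> n = 10"
      using card_verts_if_digraph_iso[of G cycle5] card_verts_if_digraph_iso[of G petersen] card_verts
        strongly_regular_graph.card_verts[OF strongly_regular_cycle5]
        strongly_regular_graph.card_verts[OF strongly_regular_petersen] by auto
    then have "d * d < 4 * 4" using card_verts_eq_degree by auto
    then show "d \<le> 3" using mult_le_mono[of 4 d 4 d] by (cases "d \<le> 3") auto
  qed
  finally show ?thesis .
qed

end
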